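(* For an infinite group $G$, its linear weight $w_l(G)$ is equal to the smallest cardinal $\kappa$ for which there are subgroups $G_i$, $i\in\kappa$, of $G$ of index $|G/G_i|\le\kappa$ such that $\bigcap_{i\in\kappa}G_i=\{1_G\}$ is the trivial subgroup of $G$.
   Context: A group topology on $G$ is a topology for which $(x,y)\mapsto xy^{-1}$ is jointly continuous; it is linear if it has a neighborhood base at the unit $1_G$ consisting of open subgroups of $G$. The weight $w(G,\tau)$ is the smallest cardinality of a base of $\tau$. The linear weight is $w_l(G)=\min\{w(G,\tau):\tau\text{ is a linear Hausdorff group topology on }G\}$. *)

theory Defs
  imports "HOL-Analysis.Abstract_Topological_Spaces" "HOL-Algebra.Left_Coset"
begin

unbundle cardinal_syntax

definition min_cardinal :: "'c rel set \<Rightarrow> 'c rel" where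
  "min_cardinal R = (SOME r. r \<in> R \<and> (\<forall>r'\<in>R. r \<le>o r'))"

(* The choice is meaningful, and unique up to =o, whenever R is a nonempty set of cardinals. *)
lemma min_cardinal:
  assumes "R \<noteq> {}" "\<And>r. r \<in> R \<Longrightarrow> Card_order r"
  shows min_cardinal_in: "min_cardinal R \<in> R"
    and min_cardinal_le: "r \<in> R \<Longrightarrow> min_cardinal R \<le>o r"
proof -
  have "\<exists>r. r \<in> R \<and> (\<forall>r'\<in>R. r \<le>o r')"
    using exists_minim_Card_order[of R] assms by blast
  then have "min_cardinal R \<in> R \<and> (\<forall>r'\<in>R. min_cardinal R \<le>o r')"
    unfolding min_cardinal_def by (rule someI_ex)
  then show "min_cardinal R \<in> R" "r \<in> R \<Longrightarrow> min_cardinal R \<le>o r"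
    by blast+
qed

definition topology_base :: "'a topology \<Rightarrow> 'a set set \<Rightarrow> bool" where
  "topology_base T B \<longleftrightarrow> openin T = arbitrary union_of (\<lambda>U. U \<in> B)"

definition weight :: "'a topology \<Rightarrow> 'a set rel" where
  "weight T = min_cardinal {|B| | B. topology_base T B}"

definition group_topology :: "('a, 'b) monoid_scheme \<Rightarrow> 'a topology \<Rightarrow> bool" where
  "group_topology G T \<longleftrightarrow>
     topspace T = carrier G \<and>
     continuous_map (prod_topology T T) T (\<lambda>(x, y). x \<otimes>\<^bsub>G\<^esub> inv\<^bsub>G\<^esub> y)"

definition linear_topology :: "('a, 'b) monoid_scheme \<Rightarrow> 'a topology \<Rightarrow> bool" where
  "linear_topology G T \<longleftrightarrow>
     neighbourhood_base_at \<one>\<^bsub>G\<^esub> (\<lambda>H. subgroup H G \<and> openin T H) T"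

definition linear_weight :: "('a, 'b) monoid_scheme \<Rightarrow> 'a set rel" where
  "linear_weight G =
     min_cardinal {weight T | T. group_topology G T \<and> linear_topology G T \<and> Hausdorff_space T}"

(* The type of kappa is independent of that of G, so cardinals of arbitrary size are covered;
   Field kappa serves as the index set. Intersecting with carrier G only matters for kappa = 0. *)
definition has_trivial_intersection_family ::
    "('a, 'b) monoid_scheme \<Rightarrow> 'k rel \<Rightarrow> bool" where
  "has_trivial_intersection_family G \<kappa> \<longleftrightarrow>
     (\<exists>H :: 'k \<Rightarrow> 'a set.
        (\<forall>i\<in>Field \<kappa>. subgroup (H i) G \<and> |lcosets\<^bsub>G\<^esub> (H i)| \<le>o \<kappa>) \<and>
        carrier G \<inter> (\<Inter>i\<in>Field \<kappa>. H i) = {\<one>\<^bsub>G\<^esub>})"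

(* The minima in weight and linear_weight range over nonempty sets of cardinals. *)

lemma weight_attained: "\<exists>B. topology_base T B \<and> weight T = |B|"
  and weight_le: "topology_base T B \<Longrightarrow> weight T \<le>o |B|"
proof -
  have "topology_base T (Collect (openin T))"
    by (auto simp: topology_base_def fun_eq_iff union_of_def arbitrary_def
        intro: exI[of _ "{_}"])
  then have ne: "{|B| | B. topology_base T B} \<noteq> {}" by blast
  have "weight T \<in> {|B| | B. topology_base T B}"
    unfolding weight_def using ne by (rule min_cardinal_in) (auto simp: card_of_Card_order)
  then show "\<exists>B. topology_base T B \<and> weight T = |B|" by auto
  show "topology_base T B \<Longrightarrow> weight T \<le>o |B|"
    unfolding weight_def using ne by (rule min_cardinal_le) (auto simp: card_of_Card_order)
qed

lemma Card_order_weight: "Card_order (weight T)"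
  using weight_attained[of T] by (metis card_of_Card_order)

lemma (in group) discrete_topology_linear_group_topology:
  "group_topology G (discrete_topology (carrier G)) \<and>
   linear_topology G (discrete_topology (carrier G)) \<and>
   Hausdorff_space (discrete_topology (carrier G))"
proof -
  have "neighbourhood_base_at \<one> (\<lambda>H. subgroup H G \<and> openin (discrete_topology (carrier G)) H)
          (discrete_topology (carrier G))"
    unfolding neighbourhood_base_at_def
  proof (intro allI impI)
    fix W assume "openin (discrete_topology (carrier G)) W \<and> \<one> \<in> W"
    then show "\<exists>U V. openin (discrete_topology (carrier G)) U \<and>
        (subgroup V G \<and> openin (discrete_topology (carrier G)) V) \<and> \<one> \<in> U \<and> U \<subseteq> V \<and> V \<subseteq> W"
      by (intro exI[of _ "{\<one>}"]) (auto simp: triv_subgroup)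
  qed
  then show ?thesis
    by (auto simp: group_topology_def linear_topology_def
        Hausdorff_space_discrete_topology prod_topology_discrete_topology [symmetric])
qed

lemma (in group) linear_weight_attained:
  "\<exists>T. group_topology G T \<and> linear_topology G T \<and> Hausdorff_space T \<and> linear_weight G = weight T"
  and linear_weight_le:
  "\<lbrakk>group_topology G T; linear_topology G T; Hausdorff_space T\<rbrakk> \<Longrightarrow> linear_weight G \<le>o weight T"
proof -
  let ?R = "{weight T | T. group_topology G T \<and> linear_topology G T \<and> Hausdorff_space T}"
  have ne: "?R \<noteq> {}" using discrete_topology_linear_group_topology by blast
  have "linear_weight G \<in> ?R"
    unfolding linear_weight_def using ne by (rule min_cardinal_in) (auto simp: Card_order_weight)
  then show "\<exists>T. group_topology G T \<and> linear_topology G T \<and> Hausdorff_space T \<and>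
      linear_weight G = weight T" by auto
  show "\<lbrakk>group_topology G T; linear_topology G T; Hausdorff_space T\<rbrakk> \<Longrightarrow> linear_weight G \<le>o weight T"
    unfolding linear_weight_def using ne by (rule min_cardinal_le) (auto simp: Card_order_weight)
qed

end

theory Submission
  imports Defs "HOL-Algebra.Free_Abelian_Groups"
begin

text \<open>
  The linear weight both admits a family of subgroups as required and is a lower bound for all
  cardinals that admit one.

  Suppose first that subgroups \<open>H i\<close>, for \<open>i\<close> in the field of a cardinal \<open>\<kappa>\<close>, have index at
  most \<open>\<kappa>\<close> and intersect trivially. Take as a subbase all sets \<open>a H\<^sub>i b\<inverse>\<close>. This family is invariant
  under left and right translation, and this makes the division map continuous. A subbasic set that contains the unit is a conjugate of some \<open>H i\<close>,
  so the finite intersections around the unit are subgroups and the topology is linear. It is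
  Hausdorff because distinct \<open>x\<close> and \<open>y\<close> lie in different left cosets of some \<open>H i\<close>.
  Since \<open>a H\<^sub>i b\<inverse>\<close> depends only on the cosets \<open>a H\<^sub>i\<close> and \<open>b H\<^sub>i\<close>, there are at most
  \<open>\<kappa> \<cdot> \<kappa> \<cdot> \<kappa>\<close> subbasic sets. If \<open>\<kappa>\<close> is infinite, the base of finite intersections has
  cardinality at most \<open>\<kappa>\<close> as well (\<open>weight_translate_topology_le\<close>). A finite \<open>\<kappa>\<close> is impossible,
  since the group embeds into the product of the coset spaces
  (\<open>finite_carrier_if_finite_index_family\<close>).

  Conversely, let \<open>B\<close> be a base of minimal cardinality of a linear Hausdorff group topology. Every
  member of \<open>B\<close> around the unit contains an open subgroup; these subgroups intersect trivially
  by the Hausdorff property. The cosets of an open subgroup are disjoint nonempty open sets, and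
  each contains a nonempty member of \<open>B\<close>, so there are at most as many cosets as members of \<open>B\<close>
  (\<open>trivial_intersection_family_weight\<close>).
\<close>

section \<open>Two-sided translates of subgroups\<close>

text \<open>
  The set \<open>a H b\<inverse>\<close>. With the inverse on the right, it depends on both parameters
  only through their left cosets modulo \<open>H\<close>.
\<close>

definition translate :: "('a, 'b) monoid_scheme \<Rightarrow> 'a set \<Rightarrow> 'a \<Rightarrow> 'a \<Rightarrow> 'a set" where
  "translate G H a b = {x \<in> carrier G. inv\<^bsub>G\<^esub> a \<otimes>\<^bsub>G\<^esub> x \<otimes>\<^bsub>G\<^esub> b \<in> H}"

definition translates :: "('a, 'b) monoid_scheme \<Rightarrow> 'a set set \<Rightarrow> 'a set set" where
  "translates G \<H> = (\<Union>H\<in>\<H>. (\<lambda>(a, b). translate G H a b) ` (carrier G \<times> carrier G))"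

definition translate_topology :: "('a, 'b) monoid_scheme \<Rightarrow> 'a set set \<Rightarrow> 'a topology" where
  "translate_topology G \<H> =
     topology (arbitrary union_of
       (finite intersection_of (\<lambda>S. S \<in> translates G \<H>) relative_to carrier G))"

context group
begin

lemma inv_mult_cancel_left:
  assumes "x \<in> carrier G" "y \<in> carrier G"
  shows "inv x \<otimes> (x \<otimes> y) = y" "x \<otimes> (inv x \<otimes> y) = y"
  using assms by (simp_all flip: m_assoc)

lemma eq_if_inv_mult_eq_one:
  assumes "x \<in> carrier G" "y \<in> carrier G" "inv x \<otimes> y = \<one>"
  shows "x = y"
  using inv_mult_cancel_left(2)[of x y] assms by simp

lemmas word_simps = m_assoc inv_mult_group inv_mult_cancel_left

text \<open>
  If the unit lies in \<open>a H b\<inverse>\<close> then \<open>a\<inverse> b \<in> H\<close>, hence \<open>a H b\<inverse> = a H a\<inverse>\<close> is a conjugate of \<open>H\<close>.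
  The closure properties are verified directly, by inserting \<open>a\<inverse> b\<close> or its inverse between the
  factors.
\<close>
lemma subgroup_translate:
  assumes "subgroup H G" "a \<in> carrier G" "b \<in> carrier G" "\<one> \<in> translate G H a b"
  shows "subgroup (translate G H a b) G"
proof -
  interpret H: subgroup H G by fact
  have ab: "inv a \<otimes> b \<in> H"
    using assms by (simp add: translate_def)
  show ?thesis
  proof
    show "translate G H a b \<subseteq> carrier G"
      by (auto simp: translate_def)
    show "\<one> \<in> translate G H a b" by fact
  next
    fix x y assume "x \<in> translate G H a b" "y \<in> translate G H a b"
    then have xy: "x \<in> carrier G" "y \<in> carrier G" "inv a \<otimes> x \<otimes> b \<in> H" "inv a \<otimes> y \<otimes> b \<in> H"
      by (auto simp: translate_def)
    have "(inv a \<otimes> x \<otimes> b) \<otimes> inv (inv a \<otimes> b) \<otimes> (inv a \<otimes> y \<otimes> b) \<in> H"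
      using ab xy by simp
    also have "(inv a \<otimes> x \<otimes> b) \<otimes> inv (inv a \<otimes> b) \<otimes> (inv a \<otimes> y \<otimes> b) = inv a \<otimes> (x \<otimes> y) \<otimes> b"
      using assms xy(1,2) by (simp add: word_simps)
    finally show "x \<otimes> y \<in> translate G H a b"
      using xy by (simp add: translate_def)
  next
    fix x assume "x \<in> translate G H a b"
    then have x: "x \<in> carrier G" "inv a \<otimes> x \<otimes> b \<in> H"
      by (auto simp: translate_def)
    have "(inv a \<otimes> b) \<otimes> inv (inv a \<otimes> x \<otimes> b) \<otimes> (inv a \<otimes> b) \<in> H"
      using ab x by simp
    also have "(inv a \<otimes> b) \<otimes> inv (inv a \<otimes> x \<otimes> b) \<otimes> (inv a \<otimes> b) = inv a \<otimes> inv x \<otimes> b"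
      using assms x(1) by (simp add: word_simps)
    finally show "inv x \<in> translate G H a b"
      using x by (simp add: translate_def)
  qed
qed

lemma lcos_eq_imp_inv_mult_mem:
  assumes "subgroup H G" "a \<in> carrier G" "a' \<in> carrier G" "a <# H = a' <# H"
  shows "inv a \<otimes> a' \<in> H"
  using assms lcos_self[of a' H] subgroup.lcos_module_imp[of H G a a'] is_group by simp

lemma translate_mono_lcos:
  assumes "subgroup H G" "a \<in> carrier G" "b \<in> carrier G" "a' \<in> carrier G" "b' \<in> carrier G"
    and "a <# H = a' <# H" "b <# H = b' <# H"
  shows "translate G H a b \<subseteq> translate G H a' b'"
proof
  interpret H: subgroup H G by fact
  fix x assume "x \<in> translate G H a b"
  then have x: "x \<in> carrier G" "inv a \<otimes> x \<otimes> b \<in> H"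
    by (auto simp: translate_def)
  have "inv a' \<otimes> a \<in> H" "inv b \<otimes> b' \<in> H"
    using assms by (simp_all add: lcos_eq_imp_inv_mult_mem)
  then have "(inv a' \<otimes> a) \<otimes> (inv a \<otimes> x \<otimes> b) \<otimes> (inv b \<otimes> b') \<in> H"
    using x by simp
  also have "(inv a' \<otimes> a) \<otimes> (inv a \<otimes> x \<otimes> b) \<otimes> (inv b \<otimes> b') = inv a' \<otimes> x \<otimes> b'"
    using assms x(1) by (simp add: word_simps)
  finally show "x \<in> translate G H a' b'"
    using x by (simp add: translate_def)
qed

text \<open>
  Choosing a representative of each coset makes the translates an image of the pairs of cosets.
  This bounds their number by the index alone; counting the pairs \<open>(a, b)\<close> would only give
  the cardinality of the whole group.
\<close>
lemma card_of_translates_of_subgroup: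
  assumes "subgroup H G"
  shows "|(\<lambda>(a, b). translate G H a b) ` (carrier G \<times> carrier G)| \<le>o |(lcosets H) \<times> (lcosets H)|"
proof -
  define rep where "rep C = (SOME a. a \<in> carrier G \<and> C = a <# H)" for C
  have rep: "rep (a <# H) \<in> carrier G" "a <# H = rep (a <# H) <# H" if "a \<in> carrier G" for a
    using someI[of "\<lambda>a'. a' \<in> carrier G \<and> a <# H = a' <# H" a] that by (auto simp: rep_def)
  have "translate G H a b \<in> (\<lambda>(C, D). translate G H (rep C) (rep D)) ` ((lcosets H) \<times> (lcosets H))"
    if ab: "a \<in> carrier G" "b \<in> carrier G" for a b
  proof (rule image_eqI)
    show "(a <# H, b <# H) \<in> (lcosets H) \<times> (lcosets H)"
      using ab by (auto simp: LCOSETS_def)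
    note reps = rep[OF ab(1)] rep[OF ab(2)]
    show "translate G H a b = (\<lambda>(C, D). translate G H (rep C) (rep D)) (a <# H, b <# H)"
      using translate_mono_lcos[OF assms ab reps(1,3) reps(2,4)]
        translate_mono_lcos[OF assms reps(1,3) ab reps(2)[symmetric] reps(4)[symmetric]] by simp
  qed
  then have "(\<lambda>(a, b). translate G H a b) ` (carrier G \<times> carrier G) \<subseteq>
      (\<lambda>(C, D). translate G H (rep C) (rep D)) ` ((lcosets H) \<times> (lcosets H))"
    by (intro image_subsetI) (elim SigmaE, simp only: prod.case)
  then show ?thesis
    by (rule surj_imp_ordLeq)
qed

section \<open>The linear topology generated by a family of subgroups\<close>

lemma topspace_translate_topology [simp]: "topspace (translate_topology G \<H>) = carrier G"
  by (simp add: translate_topology_def)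

lemma topology_base_translate_topology:
  "topology_base (translate_topology G \<H>) ((\<lambda>\<F>. carrier G \<inter> \<Inter>\<F>) ` Fpow (translates G \<H>))"
proof -
  have "(finite intersection_of (\<lambda>S. S \<in> translates G \<H>) relative_to carrier G) =
        (\<lambda>U. U \<in> (\<lambda>\<F>. carrier G \<inter> \<Inter>\<F>) ` Fpow (translates G \<H>))"
    unfolding relative_to_def intersection_of_def fun_eq_iff Fpow_def by blast
  then show ?thesis
    unfolding topology_base_def translate_topology_def
    by (metis istopology_subbase topology_inverse')
qed

lemma openin_translate:
  assumes "H \<in> \<H>" "a \<in> carrier G" "b \<in> carrier G"
  shows "openin (translate_topology G \<H>) (translate G H a b)"
  unfolding translate_topology_def openin_subbase
proof (intro arbitrary_union_of_inc relative_to_subset_inc finite_intersection_of_inc)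
  show "translate G H a b \<in> translates G \<H>"
    using assms by (auto simp: translates_def)
qed (auto simp: translate_def)

lemma group_topology_translate_topology:
  assumes "\<And>H. H \<in> \<H> \<Longrightarrow> subgroup H G"
  shows "group_topology G (translate_topology G \<H>)"
proof -
  let ?T = "translate_topology G \<H>"
  have "continuous_map (prod_topology ?T ?T) ?T (\<lambda>(x, y). x \<otimes> inv y)"
  proof (subst (3) translate_topology_def, rule continuous_map_into_topology_subbase)
    fix S assume "S \<in> translates G \<H>"
    then obtain H a b where H: "H \<in> \<H>" and ab: "a \<in> carrier G" "b \<in> carrier G"
      and S: "S = translate G H a b"
      by (auto simp: translates_def)
    interpret H: subgroup H G using assms H .
    show "openin (prod_topology ?T ?T)
        {p \<in> topspace (prod_topology ?T ?T). (case p of (x, y) \<Rightarrow> x \<otimes> inv y) \<in> S}"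
      unfolding openin_prod_topology_alt
    proof (intro allI impI)
      fix x y
      assume "(x, y) \<in> {p \<in> topspace (prod_topology ?T ?T).
        (case p of (x, y) \<Rightarrow> x \<otimes> inv y) \<in> S}"
      then have xy: "x \<in> carrier G" "y \<in> carrier G" "inv a \<otimes> (x \<otimes> inv y) \<otimes> b \<in> H"
        by (auto simp: S translate_def)
      \<comment> \<open>The choice of \<open>c\<close> puts \<open>x\<close> into \<open>a H c\<inverse>\<close> and \<open>y\<close> into \<open>b H c\<inverse>\<close>; dividing elements of these
        two sets cancels \<open>c\<close> and lands in \<open>a H b\<inverse>\<close>.\<close>
      define c where "c = inv y \<otimes> b"
      have c: "c \<in> carrier G" using xy ab by (simp add: c_def)
      have "x' \<otimes> inv y' \<in> S" if "x' \<in> translate G H a c" "y' \<in> translate G H b c" for x' y'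
      proof -
        have xy': "x' \<in> carrier G" "y' \<in> carrier G" "inv a \<otimes> x' \<otimes> c \<in> H" "inv b \<otimes> y' \<otimes> c \<in> H"
          using that by (auto simp: translate_def)
        have "(inv a \<otimes> x' \<otimes> c) \<otimes> inv (inv b \<otimes> y' \<otimes> c) \<in> H"
          using xy' by simp
        also have "(inv a \<otimes> x' \<otimes> c) \<otimes> inv (inv b \<otimes> y' \<otimes> c) = inv a \<otimes> (x' \<otimes> inv y') \<otimes> b"
          using ab c xy'(1,2) by (simp add: word_simps)
        finally show ?thesis
          using xy' by (simp add: S translate_def)
      qed
      moreover have "x \<in> translate G H a c"
        using xy ab by (simp add: translate_def c_def m_assoc)
      moreover have "y \<in> translate G H b c"
        using xy ab by (simp add: translate_def c_def word_simps)
      ultimately show "\<exists>U V. openin ?T U \<and> openin ?T V \<and> x \<in> U \<and> y \<in> V \<and>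
          U \<times> V \<subseteq> {p \<in> topspace (prod_topology ?T ?T). (case p of (x, y) \<Rightarrow> x \<otimes> inv y) \<in> S}"
        using openin_translate[OF H ab(1) c] openin_translate[OF H ab(2) c]
        by (intro exI[of _ "translate G H a c"] exI[of _ "translate G H b c"])
          (auto simp: translate_def)
    qed
  qed (auto simp flip: translate_topology_def)
  then show ?thesis
    by (simp add: group_topology_def)
qed

text \<open>
  It suffices to look at basic sets, and a basic set around the unit is already a subgroup: it is
  a finite intersection of conjugates.
\<close>
lemma linear_topology_translate_topology:
  assumes "\<And>H. H \<in> \<H> \<Longrightarrow> subgroup H G"
  shows "linear_topology G (translate_topology G \<H>)"
proof -
  let ?T = "translate_topology G \<H>"
  have *: "subgroup W G" if W_base: "W \<in> (\<lambda>\<F>. carrier G \<inter> \<Inter>\<F>) ` Fpow (translates G \<H>)" and "\<one> \<in> W" for W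
  proof -
    obtain \<F> where \<F>: "\<F> \<subseteq> translates G \<H>" and W: "W = \<Inter>(insert (carrier G) \<F>)"
      using W_base by (auto simp: Fpow_def)
    have "subgroup K G" if K: "K \<in> insert (carrier G) \<F>" for K
    proof (cases "K = carrier G")
      case True
      then show ?thesis by (simp add: subgroup_self)
    next
      case False
      then obtain H a b where "H \<in> \<H>" "a \<in> carrier G" "b \<in> carrier G" "K = translate G H a b"
        using K \<F> unfolding translates_def by blast
      moreover have "\<one> \<in> K"
        using K W \<open>\<one> \<in> W\<close> by blast
      ultimately show ?thesis
        using assms subgroup_translate by blast
    qed
    then show ?thesis
      unfolding W by (intro subgroups_Inter) auto
  qed
  have base: "openin ?T = arbitrary union_of (\<lambda>U. U \<in> (\<lambda>\<F>. carrier G \<inter> \<Inter>\<F>) ` Fpow (translates G \<H>))"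
    using topology_base_translate_topology by (simp add: topology_base_def)
  have "openin ?T W" if "W \<in> (\<lambda>\<F>. carrier G \<inter> \<Inter>\<F>) ` Fpow (translates G \<H>)" for W
    unfolding base using that by (intro arbitrary_union_of_inc)
  with * show ?thesis
    unfolding linear_topology_def neighbourhood_base_at_topology_base[OF base] by blast
qed

text \<open>
  Distinct points are separated by their two left cosets modulo a member of the family that misses
  their quotient.
\<close>
lemma Hausdorff_space_translate_topology:
  assumes subgr: "\<And>H. H \<in> \<H> \<Longrightarrow> subgroup H G" and triv: "carrier G \<inter> \<Inter>\<H> = {\<one>}"
  shows "Hausdorff_space (translate_topology G \<H>)"
  unfolding Hausdorff_space_def
proof (intro allI impI)
  fix x y assume "x \<in> topspace (translate_topology G \<H>) \<and> y \<in> topspace (translate_topology G \<H>) \<and> x \<noteq> y"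
  then have xy: "x \<in> carrier G" "y \<in> carrier G" "x \<noteq> y" by auto
  then have "inv x \<otimes> y \<noteq> \<one>"
    using eq_if_inv_mult_eq_one by blast
  then obtain H where H: "H \<in> \<H>" "inv x \<otimes> y \<notin> H"
    using xy triv by fastforce
  interpret H: subgroup H G using subgr H(1) .
  have False if "z \<in> translate G H x \<one>" "z \<in> translate G H y \<one>" for z
  proof -
    have z: "z \<in> carrier G" "inv x \<otimes> z \<in> H" "inv y \<otimes> z \<in> H"
      using that xy by (auto simp: translate_def)
    have "(inv x \<otimes> z) \<otimes> inv (inv y \<otimes> z) \<in> H"
      using z by simp
    also have "(inv x \<otimes> z) \<otimes> inv (inv y \<otimes> z) = inv x \<otimes> y"
      using xy z(1) by (simp add: word_simps)
    finally show False using H by simp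
  qed
  then have "disjnt (translate G H x \<one>) (translate G H y \<one>)"
    by (auto simp: disjnt_def)
  moreover have "x \<in> translate G H x \<one>" "y \<in> translate G H y \<one>"
    using xy by (simp_all add: translate_def)
  ultimately show "\<exists>U V. openin (translate_topology G \<H>) U \<and> openin (translate_topology G \<H>) V \<and>
      x \<in> U \<and> y \<in> V \<and> disjnt U V"
    using xy openin_translate[OF H(1)] by blast
qed

text \<open>
  Infinity of \<open>\<kappa>\<close> enters twice: a union of at most \<open>\<kappa>\<close> sets of size at most \<open>\<kappa> \<cdot> \<kappa>\<close> has size at most \<open>\<kappa>\<close>, and so
  does the collection of finite subsets of such a union.
\<close>
lemma weight_translate_topology_le:
  assumes \<kappa>: "Card_order \<kappa>" "infinite (Field \<kappa>)"
    and card: "|\<H>| \<le>o \<kappa>"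
    and H: "\<And>H. H \<in> \<H> \<Longrightarrow> subgroup H G" "\<And>H. H \<in> \<H> \<Longrightarrow> |lcosets H| \<le>o \<kappa>"
  shows "weight (translate_topology G \<H>) \<le>o \<kappa>"
proof -
  have "|(\<lambda>(a, b). translate G H a b) ` (carrier G \<times> carrier G)| \<le>o \<kappa>" if "H \<in> \<H>" for H
    using card_of_translates_of_subgroup[OF H(1)[OF that]]
      card_of_Times_ordLeq_infinite_Field[OF \<kappa>(2) H(2)[OF that] H(2)[OF that] \<kappa>(1)]
    by (rule ordLeq_transitive)
  then have "|translates G \<H>| \<le>o \<kappa>"
    unfolding translates_def
    by (intro card_of_UNION_ordLeq_infinite_Field[OF \<kappa>(2) \<kappa>(1) card] ballI)
  then have "|translates G \<H>| \<le>o |Field \<kappa>|"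
    using card_of_Field_ordIso[OF \<kappa>(1)] ordIso_symmetric ordLeq_ordIso_trans by blast
  then have "|Fpow (translates G \<H>)| \<le>o |Fpow (Field \<kappa>)|"
    by (rule card_of_Fpow_mono)
  also have "|Fpow (Field \<kappa>)| =o |Field \<kappa>|"
    using \<kappa>(2) by (rule card_of_Fpow_infinite)
  also have "|Field \<kappa>| =o \<kappa>"
    using \<kappa>(1) by (rule card_of_Field_ordIso)
  finally have Fpow: "|Fpow (translates G \<H>)| \<le>o \<kappa>" .
  have "weight (translate_topology G \<H>) \<le>o |(\<lambda>\<F>. carrier G \<inter> \<Inter>\<F>) ` Fpow (translates G \<H>)|"
    using topology_base_translate_topology by (rule weight_le)
  also have "|(\<lambda>\<F>. carrier G \<inter> \<Inter>\<F>) ` Fpow (translates G \<H>)| \<le>o |Fpow (translates G \<H>)|"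
    by (rule card_of_image)
  also note Fpow
  finally show ?thesis .
qed

section \<open>Families of subgroups with trivial intersection\<close>

text \<open>
  Sending an element to the tuple of its left cosets is injective when the subgroups intersect
  trivially, and here the target is a finite product of finite sets.
\<close>
lemma finite_carrier_if_finite_index_family:
  assumes "finite I" and subgr: "\<And>i. i \<in> I \<Longrightarrow> subgroup (H i) G"
    and fin: "\<And>i. i \<in> I \<Longrightarrow> finite (lcosets (H i))"
    and triv: "carrier G \<inter> (\<Inter>i\<in>I. H i) = {\<one>}"
  shows "finite (carrier G)"
proof -
  let ?f = "\<lambda>x. \<lambda>i\<in>I. x <# H i"
  have "inj_on ?f (carrier G)"
  proof (rule inj_onI)
    fix x y assume xy: "x \<in> carrier G" "y \<in> carrier G" "?f x = ?f y"
    have "x <# H i = y <# H i" if "i \<in> I" for i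
      using fun_cong[OF xy(3), of i] that by simp
    then have "inv x \<otimes> y \<in> H i" if "i \<in> I" for i
      using lcos_eq_imp_inv_mult_mem[OF subgr xy(1,2)] that by simp
    then have "inv x \<otimes> y \<in> carrier G \<inter> (\<Inter>i\<in>I. H i)"
      using xy(1,2) by simp
    then have "inv x \<otimes> y = \<one>"
      unfolding triv by simp
    then show "x = y"
      using eq_if_inv_mult_eq_one[OF xy(1,2)] by simp
  qed
  moreover have "?f ` carrier G \<subseteq> (\<Pi>\<^sub>E i\<in>I. lcosets (H i))"
    by (auto simp: LCOSETS_def)
  moreover have "finite (\<Pi>\<^sub>E i\<in>I. lcosets (H i))"
    using assms(1) fin by (rule finite_PiE)
  ultimately show ?thesis
    by (rule inj_on_finite)
qed

text \<open>
  The topology generated by the translates of the family is one of those over which the linear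
  weight is minimised. The bound on its weight applies once \<open>\<kappa>\<close> is known to be infinite, which is
  where infinity of the group is used.
\<close>
lemma linear_weight_le_trivial_intersection_family:
  assumes inf: "infinite (carrier G)" and \<kappa>: "Card_order \<kappa>"
    and fam: "has_trivial_intersection_family G \<kappa>"
  shows "linear_weight G \<le>o \<kappa>"
proof -
  obtain H where subgr: "\<And>i. i \<in> Field \<kappa> \<Longrightarrow> subgroup (H i) G"
    and index: "\<And>i. i \<in> Field \<kappa> \<Longrightarrow> |lcosets (H i)| \<le>o \<kappa>"
    and triv: "carrier G \<inter> (\<Inter>i\<in>Field \<kappa>. H i) = {\<one>}"
    using fam unfolding has_trivial_intersection_family_def by blast
  have Field: "|Field \<kappa>| =o \<kappa>"
    using \<kappa> by (rule card_of_Field_ordIso)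
  have inf_\<kappa>: "infinite (Field \<kappa>)"
  proof
    assume fin: "finite (Field \<kappa>)"
    have "finite (lcosets (H i))" if "i \<in> Field \<kappa>" for i
      using index[OF that] Field fin
      by (meson card_of_ordLeq_finite ordIso_symmetric ordLeq_ordIso_trans)
    then show False
      using finite_carrier_if_finite_index_family[OF fin subgr _ triv] inf by blast
  qed
  let ?T = "translate_topology G (H ` Field \<kappa>)"
  have "linear_weight G \<le>o weight ?T"
    using subgr triv
    by (intro linear_weight_le group_topology_translate_topology linear_topology_translate_topology
        Hausdorff_space_translate_topology) auto
  also have "weight ?T \<le>o \<kappa>"
    using \<kappa> inf_\<kappa> subgr index ordLeq_ordIso_trans[OF card_of_image Field]
    by (intro weight_translate_topology_le) auto
  finally show ?thesis .
qed

section \<open>Open subgroups of a linear Hausdorff group topology\<close>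

text \<open>
  A left coset is the preimage of the subgroup under left multiplication by \<open>a\<inverse>\<close>. This
  multiplication is continuous, being the composite of the maps \<open>y \<mapsto> 1 y\<inverse>\<close> and \<open>y \<mapsto> a\<inverse> y\<inverse>\<close>,
  each of which is division with one argument fixed.
\<close>
lemma openin_lcoset:
  assumes "group_topology G T" "subgroup H G" "openin T H" "a \<in> carrier G"
  shows "openin T (a <# H)"
proof -
  interpret H: subgroup H G by fact
  have top: "topspace T = carrier G"
    and div: "continuous_map (prod_topology T T) T (\<lambda>(x, y). x \<otimes> inv y)"
    using assms(1) by (auto simp: group_topology_def)
  have div_left: "continuous_map T T (\<lambda>y. c \<otimes> inv y)" if "c \<in> carrier G" for c
    using that top continuous_map_compose[OF continuous_map_pairedI div, of T "\<lambda>_. c" "\<lambda>y. y"]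
    by (simp add: o_def)
  have "continuous_map T T (\<lambda>y. inv a \<otimes> inv (\<one> \<otimes> inv y))"
    using continuous_map_compose[OF div_left[of \<one>] div_left[of "inv a"]] assms(4)
    by (simp add: o_def)
  then have "openin T {y \<in> topspace T. inv a \<otimes> inv (\<one> \<otimes> inv y) \<in> H}"
    using assms(3) by (rule openin_continuous_map_preimage)
  also have "{y \<in> topspace T. inv a \<otimes> inv (\<one> \<otimes> inv y) \<in> H} = a <# H"
  proof (rule Set.set_eqI)
    fix y
    show "y \<in> {y \<in> topspace T. inv a \<otimes> inv (\<one> \<otimes> inv y) \<in> H} \<longleftrightarrow> y \<in> a <# H"
    proof (cases "y \<in> carrier G")
      case True
      then show ?thesis
        using assms(4) H.lcos_module_imp[OF is_group] H.lcos_module_rev[OF is_group]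
        by (auto simp: top)
    next
      case False
      then show ?thesis
        using assms(4) H.elemlcos_carrier[OF is_group] by (auto simp: top)
    qed
  qed
  finally show ?thesis .
qed

text \<open>
  A choice of a nonempty basic set inside each coset is injective, because distinct cosets are
  disjoint.
\<close>
lemma index_open_subgroup_le_base:
  assumes "group_topology G T" "topology_base T B" "subgroup H G" "openin T H"
  shows "|lcosets H| \<le>o |B|"
proof -
  have "\<exists>W\<in>B. W \<noteq> {} \<and> W \<subseteq> C" if C: "C \<in> lcosets H" for C
  proof -
    obtain a where a: "a \<in> carrier G" "C = a <# H"
      using C by (auto simp: LCOSETS_def)
    then have "openin T C" "a \<in> C"
      using openin_lcoset assms lcos_self by auto
    then show ?thesis
      using assms(2) by (auto simp: topology_base_def union_of_def)
  qed
  then obtain W where W: "\<And>C. C \<in> lcosets H \<Longrightarrow> W C \<in> B \<and> W C \<noteq> {} \<and> W C \<subseteq> C"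
    by metis
  have "inj_on W (lcosets H)"
    using W lcos_disjoint[OF assms(3)] by (intro inj_onI) (metis disjoint_iff subsetD ex_in_conv)
  then show ?thesis
    using W by (intro card_of_ordLeqI) auto
qed

lemma trivial_intersection_family_weight:
  assumes T: "group_topology G T" "linear_topology G T" "Hausdorff_space T"
  shows "has_trivial_intersection_family G (weight T)"
proof -
  have top: "topspace T = carrier G"
    using T(1) by (simp add: group_topology_def)
  obtain B where base: "topology_base T B" and weight: "weight T = |B|"
    using weight_attained by blast
  have B_open: "openin T U" if "U \<in> B" for U
    using base that by (simp add: topology_base_def arbitrary_union_of_inc)
  \<comment> \<open>The family is indexed by all of \<open>B\<close>; a basic set that misses the unit gets the whole group,
    which has index one and does not affect the intersection.\<close>
  have "\<exists>K. subgroup K G \<and> openin T K \<and> (\<one> \<in> U \<longrightarrow> K \<subseteq> U)" if "U \<in> B" for U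
  proof (cases "\<one> \<in> U")
    case True
    then show ?thesis
      using T(2) B_open[OF that] unfolding linear_topology_def neighbourhood_base_at_def by meson
  next
    case False
    then show ?thesis
      using subgroup_self top openin_topspace[of T] by auto
  qed
  then obtain K where K: "\<And>U. U \<in> B \<Longrightarrow> subgroup (K U) G \<and> openin T (K U) \<and> (\<one> \<in> U \<longrightarrow> K U \<subseteq> U)"
    by metis
  have "x = \<one>" if x: "x \<in> carrier G" "\<And>U. U \<in> B \<Longrightarrow> x \<in> K U" for x
  proof (rule ccontr)
    assume "x \<noteq> \<one>"
    then obtain V where V: "openin T V" "\<one> \<in> V" "x \<notin> V"
      using T(3) x(1) top unfolding Hausdorff_space_def disjnt_iff by (metis one_closed)
    then obtain U where "U \<in> B" "\<one> \<in> U" "U \<subseteq> V"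
      using base by (auto simp: topology_base_def union_of_def)
    then show False
      using K x(2) V(3) by blast
  qed
  then have "carrier G \<inter> (\<Inter>U\<in>B. K U) = {\<one>}"
    using K subgroup.one_closed by fastforce
  then show ?thesis
    unfolding has_trivial_intersection_family_def weight Field_card_of
    using K index_open_subgroup_le_base[OF T(1) base] by blast
qed

end

theorem proposition3:
  fixes G :: "('a, 'b) monoid_scheme"
  assumes "group G" and "infinite (carrier G)"
  shows "Card_order (linear_weight G) \<and>
         has_trivial_intersection_family G (linear_weight G) \<and>
         (\<forall>\<kappa> :: 'k rel. Card_order \<kappa> \<and> has_trivial_intersection_family G \<kappa>
            \<longrightarrow> linear_weight G \<le>o \<kappa>)"
proof -
  interpret group G by fact
  obtain T where T: "group_topology G T" "linear_topology G T" "Hausdorff_space T"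
    and eq: "linear_weight G = weight T"
    using linear_weight_attained by blast
  show ?thesis
    using trivial_intersection_family_weight[OF T] Card_order_weight[of T]
      linear_weight_le_trivial_intersection_family[OF assms(2)]
    by (auto simp: eq)
qed

end
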